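(* Let $u=(u_1,u_2,u_3,u_4)$, $u_i\ge0$, be a continuous solution of the two-dimensional Broadwell system $$\begin{aligned} \partial_t u_1+\mathbf c_1\cdot\nabla u_1&=u_2u_4-u_1u_3, &\quad \partial_t u_3+\mathbf c_3\cdot\nabla u_3&=u_2u_4-u_1u_3,\\ \partial_t u_2+\mathbf c_2\cdot\nabla u_2&=u_1u_3-u_2u_4, &\quad \partial_t u_4+\mathbf c_4\cdot\nabla u_4&=u_1u_3-u_2u_4, \end{aligned}$$ with $\mathbf c_1=(1,1)$, $\mathbf c_2=(1,-1)$, $\mathbf c_3=(-1,-1)$, $\mathbf c_4=(-1,1)$. Fix any point $(t^*,x^* )$, $t^*>0$, $x^*\in\mathbb R^2$, and consider the corresponding rescaled variables $$\tau=-\ln(t^*-t),\qquad \xi=(\xi_1,\xi_2)=\frac{x-x^*}{t^*-t},\qquad w_i(\tau,\xi)=(t^*-t)\,u_i(t,x).$$ If $$\max_{|\xi_1|,|\xi_2|\le1}w_i(\tau,\xi_1,\xi_2)\le\theta\ln\tau,\qquad i=1,2,3,4,$$ for some $\theta<1/4$ and all $\tau$ sufficiently large, then $$\lim_{\tau\to\infty}w_i(\tau,\xi)=0,\qquad i=1,2,3,4,$$ uniformly for $\xi\in\mathbb R^2$ in compact sets. Therefore $(t^*,x^* )$ is not a blow-up point.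
   Context: Here $u_i=u_i(t,x)$, $x\in\mathbb R^2$, are densities of particles moving with speed $\mathbf c_i$. The solution is taken continuous on $[0,t^*[\,\times\mathbb R^2$, each equation being satisfied along the characteristic lines $\dot x=\mathbf c_i$. A point $(t^*,x^* )$ is a blow-up point if $\limsup_{x\to x^*,\,t\to t^*-}u_i(t,x)=\infty$ for some $i$. *)

theory Defs
  imports "HOL-Analysis.Analysis"
begin

text \<open>
  The four species are indexed by the four-element type \<open>4\<close>, whose elements are
  \<open>1, 2, 3, 4\<close> (with \<open>4 = 0\<close>).
\<close>

definition broadwell_speed :: "4 \<Rightarrow> real^2" where
  "broadwell_speed i =
     (if i = 1 then vector [1, 1]
      else if i = 2 then vector [1, -1]
      else if i = 3 then vector [-1, -1]
      else vector [-1, 1])"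

definition broadwell_collision :: "(4 \<Rightarrow> real) \<Rightarrow> 4 \<Rightarrow> real" where
  "broadwell_collision v i =
     (if i = 1 \<or> i = 3 then v 2 * v 4 - v 1 * v 3 else v 1 * v 3 - v 2 * v 4)"

text \<open>
  \<open>u i t x\<close> is the density of species \<open>i\<close>. The equations are required along every characteristic
  line \<open>s \<mapsto> (s, y + s c\<^sub>i)\<close>, where \<open>y\<close> is its foot at time \<open>0\<close>; the derivative at
  \<open>s = 0\<close> is one-sided.
\<close>

definition broadwell_solution :: "real \<Rightarrow> (4 \<Rightarrow> real \<Rightarrow> real^2 \<Rightarrow> real) \<Rightarrow> bool" where
  "broadwell_solution T u \<longleftrightarrow>
     (\<forall>i. continuous_on ({0..<T} \<times> UNIV) (\<lambda>(t, x). u i t x)) \<and>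
     (\<forall>i y. \<forall>t\<in>{0..<T}.
        ((\<lambda>s. u i s (y + s *\<^sub>R broadwell_speed i)) has_real_derivative
           broadwell_collision (\<lambda>j. u j t (y + t *\<^sub>R broadwell_speed i)) i)
        (at t within {0..<T}))"

text \<open>
  The rescaled variables solved for \<open>(t, x)\<close>: \<open>T - t = exp (- \<tau>)\<close> and
  \<open>x = X + exp (- \<tau>) \<xi>\<close>; the time \<open>t\<close> is in \<open>{0..<T}\<close> iff \<open>\<tau> \<ge> - ln T\<close>.
\<close>

definition rescaled ::
    "(4 \<Rightarrow> real \<Rightarrow> real^2 \<Rightarrow> real) \<Rightarrow> real \<Rightarrow> real^2 \<Rightarrow> 4 \<Rightarrow> real \<Rightarrow> real^2 \<Rightarrow> real" where
  "rescaled u T X i \<tau> \<xi> = exp (- \<tau>) * u i (T - exp (- \<tau>)) (X + exp (- \<tau>) *\<^sub>R \<xi>)"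

lemma rescaled_eq:
  assumes "t < T"
  shows "rescaled u T X i (- ln (T - t)) ((x - X) /\<^sub>R (T - t)) = (T - t) * u i t x"
  using assms by (simp add: rescaled_def)

text \<open>
  The limit superior is joint in \<open>t \<rightarrow> T-\<close> and \<open>x \<rightarrow> X\<close>, the value \<open>x = X\<close> being allowed.
\<close>

definition blow_up_point :: "(4 \<Rightarrow> real \<Rightarrow> real^2 \<Rightarrow> real) \<Rightarrow> real \<Rightarrow> real^2 \<Rightarrow> bool" where
  "blow_up_point u T X \<longleftrightarrow>
     (\<exists>i. Limsup (at_left T \<times>\<^sub>F nhds X) (\<lambda>(t, x). ereal (u i t x)) = \<infinity>)"

end

theory Submission
  imports Defs "HOL-Real_Asymp.Real_Asymp"
begin

text \<open>
  Particles of two species whose speeds have the same first component stay together on a moving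
  line. On it, with \<open>r = T - t\<close> and \<open>y\<close> the second coordinate relative to \<open>X\<close>, take the
  characteristic coordinates \<open>p = r - y\<close>, \<open>q = r + y\<close>: one species moves with decreasing \<open>p\<close>,
  the other with decreasing \<open>q\<close>, and the mass crossing \<open>p = 0\<close> or \<open>q = 0\<close> has left the backward
  cone of \<open>(T, X)\<close> for good. A particle changes species at a rate at most \<open>M / r\<close>, where
  \<open>M = ln (3 N) / 4\<close> for \<open>\<tau> \<in> [N, 3 N]\<close>, so per unit of \<open>\<tau>\<close> a fraction of order \<open>2\<^sup>-\<^sup>M\<close> of the
  mass leaves the cone. As this is at least a power \<open>N\<^sup>-\<^sup>\<alpha>\<close> with \<open>\<alpha> < 1\<close>, the mass left at
  \<open>\<tau> = 2 N\<close> is smaller than every power of \<open>N\<close>. This is made precise by a weight which is homogeneous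
  of degree \<open>-l\<close> and a supersolution of the adjoint system for all admissible rates.

  The partner species crosses a characteristic at most once, hence its integral along the
  characteristic is bounded by the mass, and Duhamel's formula gives \<open>w\<^sub>i < 1/4\<close> on the whole
  square at \<open>\<tau> = 3 N\<close>. From there on, comparison with a supersolution on a slightly larger
  cone bounds \<open>u\<close> near \<open>(T, X)\<close> up to time \<open>T\<close>.
\<close>

subsection \<open>The weight\<close>

text \<open>
  The weight \<open>q\<^sup>-\<^sup>l h(p / q)\<close> is a supersolution on \<open>p \<le> q\<close> iff
  \<open>(1 + z) h' \<ge> M (z\<^sup>-\<^sup>l - h)\<close> for \<open>0 < z \<le> 1\<close>, with \<open>h 1 = 1\<close>. The equality case, after
  multiplication by the integrating factor \<open>(1 + z)\<^sup>M\<^sup>-\<^sup>1\<close>, has no closed form; \<open>profile\<close> is the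
  solution obtained by replacing that factor by its maximum \<open>2\<^sup>M\<^sup>-\<^sup>1\<close> in front of the part
  \<open>z\<^sup>-\<^sup>l - 1\<close> of the source. Its derivative vanishes at \<open>1\<close>, so that continuing it by \<open>1\<close>
  for \<open>z > 1\<close> keeps it continuously differentiable.
\<close>

definition excess :: "real \<Rightarrow> real \<Rightarrow> real" where
  "excess l z = z + (l - z powr (1 - l)) / (1 - l)"

definition profile :: "real \<Rightarrow> real \<Rightarrow> real \<Rightarrow> real" where
  "profile M l z = 1 - M * 2 powr (M - 1) * excess l z * (1 + z) powr (-M)"

definition profile_deriv :: "real \<Rightarrow> real \<Rightarrow> real \<Rightarrow> real" where
  "profile_deriv M l z =
     M * 2 powr (M - 1) * (1 + z) powr (-M) * (z powr (-l) - 1 + M * excess l z / (1 + z))"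

lemma excess_one: "0 < l \<Longrightarrow> l < 1 \<Longrightarrow> excess l 1 = 0"
  by (simp add: excess_def divide_simps)

text \<open>Weighted AM-GM for \<open>z\<close> and \<open>1\<close> with weights
  \<open>1 - l\<close> and \<open>l\<close>; this covers \<open>z > 1\<close> as well.\<close>

lemma excess_nonneg:
  assumes "0 < l" "l < 1" "0 < z"
  shows "0 \<le> excess l z"
proof -
  have "z powr (1 - l) * 1 powr l \<le> (1 - l) * z + l * 1"
    by (rule Youngs_inequality_0) (use assms in auto)
  then have "0 \<le> ((1 - l) * z + l - z powr (1 - l)) / (1 - l)"
    using assms by simp
  also have "\<dots> = excess l z"
    using assms by (simp add: excess_def field_simps)
  finally show ?thesis .
qed

lemma excess_le:
  assumes "0 < l" "l < 1" "0 < z" "z \<le> 1"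
  shows "excess l z \<le> l / (1 - l)"
proof -
  have "z = z powr 1" using assms by simp
  also have "\<dots> \<le> z powr (1 - l)"
    using assms by (intro powr_mono') auto
  also have "\<dots> \<le> z powr (1 - l) / (1 - l)"
    using assms by (simp add: field_simps)
  finally show ?thesis
    by (simp add: excess_def diff_divide_distrib)
qed

lemma excess_has_real_derivative:
  assumes "0 < l" "l < 1" "0 < z"
  shows "(excess l has_real_derivative 1 - z powr (-l)) (at z)"
proof -
  have "((\<lambda>z. z powr (1 - l)) has_real_derivative (1 - l) * z powr (-l)) (at z)"
    using has_real_derivative_powr[OF assms(3), of "1 - l"] by simp
  from DERIV_add[OF DERIV_ident DERIV_cdivide[OF DERIV_diff[OF DERIV_const this], of l "1 - l"]]
  show ?thesis
    using assms unfolding excess_def by simp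
qed

lemma profile_one: "0 < l \<Longrightarrow> l < 1 \<Longrightarrow> profile M l 1 = 1"
  by (simp add: profile_def excess_one)

lemma profile_deriv_one: "0 < l \<Longrightarrow> l < 1 \<Longrightarrow> profile_deriv M l 1 = 0"
  by (simp add: profile_deriv_def excess_one)

lemma profile_le_one: "0 < l \<Longrightarrow> l < 1 \<Longrightarrow> 0 < M \<Longrightarrow> 0 < z \<Longrightarrow> profile M l z \<le> 1"
  by (simp add: profile_def excess_nonneg)

text \<open>The smallness condition on \<open>l\<close> keeps
  \<open>M * 2 powr (M - 1) * excess l z\<close> below 1/2, while \<open>(1 + z) powr M\<close> lies
  between 1 and \<open>2 powr M\<close>. The loss of a factor \<open>2 powr M\<close> reappears in
  \<open>outflow_le\<close>.\<close>

lemma profile_ge: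
  assumes "0 < l" "l < 1" "1 \<le> M" "M * 2 powr M * (l / (1 - l)) \<le> 1" "0 < z" "z \<le> 1"
  shows "1 / (2 * 2 powr M) \<le> profile M l z"
proof -
  have "M * 2 powr (M - 1) * excess l z \<le> M * 2 powr (M - 1) * (l / (1 - l))"
    using assms by (intro mult_left_mono excess_le) auto
  also have "\<dots> = M * 2 powr M * (l / (1 - l)) / 2"
    by (simp add: powr_diff)
  also have "\<dots> \<le> 1 / 2"
    by (rule divide_right_mono[OF assms(4)]) simp
  also have "1 / 2 \<le> (1 + z) powr M - 1 / 2"
    using assms ge_one_powr_ge_zero[of "1 + z" M] by simp
  finally have "1 / 2 \<le> (1 + z) powr M - M * 2 powr (M - 1) * excess l z"
    by simp
  then have "1 / 2 / (1 + z) powr M \<le> ((1 + z) powr M - M * 2 powr (M - 1) * excess l z) / (1 + z) powr M"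
    using assms by (intro divide_right_mono) auto
  also have "\<dots> = profile M l z"
    using assms by (simp add: profile_def powr_minus_divide diff_divide_distrib)
  finally have "1 / 2 / (1 + z) powr M \<le> profile M l z" .
  moreover have "1 / (2 * 2 powr M) \<le> 1 / 2 / (1 + z) powr M"
    using assms by (auto intro!: divide_left_mono powr_mono2)
  ultimately show ?thesis by linarith
qed

lemma profile_has_real_derivative:
  assumes "0 < l" "l < 1" "0 < z"
  shows "(profile M l has_real_derivative profile_deriv M l z) (at z)"
proof -
  define A where "A = M * 2 powr (M - 1)"
  have "((\<lambda>z. (1 + z) powr (-M)) has_real_derivative -M * (1 + z) powr (-M - 1)) (at z)"
    using assms by (auto intro!: derivative_eq_intros)
  then have "((\<lambda>z. (1 + z) powr (-M)) has_real_derivative -M * ((1 + z) powr (-M) / (1 + z))) (at z)"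
    using assms by (simp add: powr_diff)
  note DERIV_mult[OF DERIV_cmult[OF excess_has_real_derivative[OF assms], of A] this]
  from DERIV_diff[OF DERIV_const this, of 1]
  have "((\<lambda>z. 1 - A * excess l z * (1 + z) powr (-M)) has_real_derivative
      A * (1 + z) powr (-M) * (z powr (-l) - 1 + M * excess l z / (1 + z))) (at z)"
    by (rule DERIV_cong) (simp add: algebra_simps)
  then show ?thesis
    unfolding profile_def[abs_def] profile_deriv_def A_def .
qed

text \<open>Both sides contain the same multiple of \<open>excess l z\<close>, which cancels. What
  remains is \<open>(1 + z) powr (M - 1) \<le> 2 powr (M - 1)\<close> times a nonnegative
  source.\<close>

lemma profile_supersolution:
  assumes "0 < l" "l < 1" "1 \<le> M" "0 < z" "z \<le> 1"
  shows "M * (z powr (-l) - profile M l z) \<le> (1 + z) * profile_deriv M l z"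
proof -
  let ?e = "z powr (-l) - 1"
  have e: "0 \<le> ?e"
    using assms powr_mono'[of "-l" 0 z] by simp
  have "(1 + z) powr (M - 1) \<le> 2 powr (M - 1)"
    using assms by (intro powr_mono2) auto
  then have "1 \<le> 2 powr (M - 1) * (1 + z) powr (1 - M)"
    using assms by (simp add: powr_diff field_simps)
  then have "M * ?e * 1 \<le> M * ?e * (2 powr (M - 1) * (1 + z) powr (1 - M))"
    using e assms by (intro mult_left_mono) auto
  moreover have "(1 + z) powr (1 - M) = (1 + z) * (1 + z) powr (-M)"
    using assms by (simp add: powr_diff powr_minus divide_inverse)
  moreover have "(1 + z) * profile_deriv M l z =
     M * 2 powr (M - 1) * (1 + z) powr (-M) * ((1 + z) * ?e + M * excess l z)"
    using assms unfolding profile_deriv_def by (simp add: field_simps)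
  ultimately show ?thesis
    unfolding profile_def by (simp add: algebra_simps)
qed

lemma profile_min_has_real_derivative:
  assumes "0 < l" "l < 1" "0 < z"
  shows "((\<lambda>z. profile M l (min 1 z)) has_real_derivative profile_deriv M l (min 1 z)) (at z)"
proof (cases z "1::real" rule: linorder_cases)
  case less
  then have "\<forall>\<^sub>F y in nhds z. profile M l (min 1 y) = profile M l y"
    by (auto intro!: eventually_mono[OF eventually_nhds_in_open[of "{..<1}"]])
  then show ?thesis
    using less profile_has_real_derivative[OF assms, of M] by (simp add: DERIV_cong_ev)
next
  case greater
  then have "\<forall>\<^sub>F y in nhds z. profile M l (min 1 y) = 1"
    using assms by (auto intro!: eventually_mono[OF eventually_nhds_in_open[of "{1<..}"]] simp: profile_one)
  then show ?thesis
    using greater assms by (simp add: DERIV_cong_ev profile_deriv_one)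
next
  case equal
  have "((\<lambda>y. (profile M l y - profile M l 1) / (y - 1)) \<longlongrightarrow> 0) (at 1)"
    using profile_has_real_derivative[of l 1 M] assms by (simp add: has_field_derivative_iff profile_deriv_one)
  then have left: "((\<lambda>y. (profile M l y - profile M l 1) / (y - 1)) \<longlongrightarrow> 0) (at_left 1)"
    by (simp add: filterlim_at_split)
  have "((\<lambda>y. (profile M l (min 1 y) - profile M l 1) / (y - 1)) \<longlongrightarrow> 0) (at_left 1)"
    by (rule Lim_transform_eventually[OF left]) (auto simp: eventually_at_filter)
  moreover have "((\<lambda>y. (profile M l (min 1 y) - profile M l 1) / (y - 1)) \<longlongrightarrow> 0) (at_right 1)"
    by (rule Lim_transform_eventually[OF tendsto_const]) (auto simp: eventually_at_filter)
  ultimately show ?thesis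
    using equal assms by (simp add: has_field_derivative_iff filterlim_at_split profile_deriv_one)
qed

lemma continuous_on_profile [continuous_intros]:
  assumes "0 < l" "l < 1" "continuous_on S h" "\<And>x. x \<in> S \<Longrightarrow> 0 < h x"
  shows "continuous_on S (\<lambda>x. profile M l (h x))"
proof -
  have "1 + h x \<noteq> 0" "h x \<noteq> 0" if "x \<in> S" for x
    using assms(4)[OF that] by auto
  then show ?thesis
    unfolding profile_def excess_def using assms by (intro continuous_intros) auto
qed

lemma continuous_on_profile_deriv [continuous_intros]:
  assumes "0 < l" "l < 1" "continuous_on S h" "\<And>x. x \<in> S \<Longrightarrow> 0 < h x"
  shows "continuous_on S (\<lambda>x. profile_deriv M l (h x))"
proof -
  have "1 + h x \<noteq> 0" "h x \<noteq> 0" if "x \<in> S" for x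
    using assms(4)[OF that] by auto
  then show ?thesis
    unfolding profile_deriv_def excess_def using assms by (intro continuous_intros) auto
qed

text \<open>The weight of a particle moving with decreasing \<open>p\<close>; the species moving
  with decreasing \<open>q\<close> receives \<open>weight M l q p\<close>. For
  \<open>p \<ge> q\<close> it is \<open>q powr (-l)\<close>, and only for \<open>p < q\<close>, on
  the way to the exit \<open>p = 0\<close>, does the profile lower it.\<close>

definition weight :: "real \<Rightarrow> real \<Rightarrow> real \<Rightarrow> real \<Rightarrow> real" where
  "weight M l p q = q powr (-l) * profile M l (min 1 (p / q))"

definition weight_deriv :: "real \<Rightarrow> real \<Rightarrow> real \<Rightarrow> real \<Rightarrow> real" where
  "weight_deriv M l p q = q powr (-l - 1) * profile_deriv M l (min 1 (p / q))"

lemma weight_has_real_derivative: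
  assumes "0 < l" "l < 1" "0 < p" "0 < q"
  shows "((\<lambda>p. weight M l p q) has_real_derivative weight_deriv M l p q) (at p)"
proof -
  have "((\<lambda>p. p / q) has_real_derivative 1 / q) (at p)"
    using assms by (auto intro!: derivative_eq_intros)
  from DERIV_chain2[OF profile_min_has_real_derivative this] assms
  have "((\<lambda>p. profile M l (min 1 (p / q))) has_real_derivative
      profile_deriv M l (min 1 (p / q)) * (1 / q)) (at p)"
    by simp
  from DERIV_cmult[OF this, of "q powr (-l)"]
  show ?thesis
    unfolding weight_def weight_deriv_def using assms by (simp add: powr_diff mult.commute)
qed

lemma continuous_on_weight:
  assumes "0 < l" "l < 1" "continuous_on S p" "continuous_on S q"
    "\<And>x. x \<in> S \<Longrightarrow> 0 < p x" "\<And>x. x \<in> S \<Longrightarrow> 0 < q x"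
  shows "continuous_on S (\<lambda>x. weight M l (p x) (q x))"
proof -
  have "q x \<noteq> 0" if "x \<in> S" for x
    using assms(6)[OF that] by auto
  then show ?thesis
    unfolding weight_def using assms by (intro continuous_intros) auto
qed

lemma continuous_on_weight_deriv:
  assumes "0 < l" "l < 1" "continuous_on S p" "continuous_on S q"
    "\<And>x. x \<in> S \<Longrightarrow> 0 < p x" "\<And>x. x \<in> S \<Longrightarrow> 0 < q x"
  shows "continuous_on S (\<lambda>x. weight_deriv M l (p x) (q x))"
proof -
  have "q x \<noteq> 0" if "x \<in> S" for x
    using assms(6)[OF that] by auto
  then show ?thesis
    unfolding weight_deriv_def using assms by (intro continuous_intros) auto
qed

lemma weight_le:
  assumes "0 < l" "l < 1" "0 < M" "0 < p" "0 < q"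
  shows "weight M l p q \<le> q powr (-l)"
  unfolding weight_def
  using mult_left_mono[OF profile_le_one[OF assms(1-3), of "min 1 (p / q)"], of "q powr (-l)"] assms
  by simp

lemma weight_ge:
  assumes "0 < l" "l < 1" "1 \<le> M" "M * 2 powr M * (l / (1 - l)) \<le> 1" "0 < p" "0 < q" "q \<le> s"
  shows "s powr (-l) / (2 * 2 powr M) \<le> weight M l p q"
proof -
  have "s powr (-l) * (1 / (2 * 2 powr M)) \<le> q powr (-l) * profile M l (min 1 (p / q))"
    using assms by (intro mult_mono profile_ge powr_mono2') auto
  then show ?thesis
    by (simp add: weight_def)
qed

lemma weight_nonneg:
  assumes "0 < l" "l < 1" "1 \<le> M" "M * 2 powr M * (l / (1 - l)) \<le> 1" "0 < p" "0 < q"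
  shows "0 \<le> weight M l p q"
  using weight_ge[OF assms order_refl] by (rule order_trans[rotated]) simp

text \<open>What a particle gains by changing species at rate \<open>a\<close> is paid for by the
  decrease of its weight along its path. For \<open>p \<le> q\<close> homogeneity reduces this to
  \<open>profile_supersolution\<close> at \<open>z = p / q\<close>. For \<open>p > q\<close> the
  weight does not vary with \<open>p\<close>, and a change of species gains nothing.\<close>

lemma weight_supersolution:
  assumes "0 < l" "l < 1" "1 \<le> M" "0 < p" "0 < q" "0 \<le> a" "a \<le> M / (p + q)"
  shows "a * (weight M l q p - weight M l p q) \<le> weight_deriv M l p q"
proof (cases "p \<le> q")
  case True
  let ?z = "p / q" and ?w = "q powr (-l)"
  have z: "0 < ?z" "?z \<le> 1" "min 1 ?z = ?z" "min 1 (q / p) = 1"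
    using assms True by auto
  have p: "p powr (-l) = ?w * ?z powr (-l)"
    using assms by (simp add: powr_divide)
  have diff: "weight M l q p - weight M l p q = ?w * (?z powr (-l) - profile M l ?z)"
    unfolding weight_def z p using assms by (simp add: profile_one algebra_simps)
  have "1 \<le> ?z powr (-l)"
    using assms z powr_mono'[of "-l" 0 ?z] by simp
  \<comment> \<open>This sign allows \<open>a\<close> to be replaced by its largest admissible value
    \<open>M / (p + q)\<close>.\<close>
  then have nn: "0 \<le> ?z powr (-l) - profile M l ?z"
    using profile_le_one[of l M ?z] assms z by linarith
  have "a * (weight M l q p - weight M l p q) \<le> M / (p + q) * (?w * (?z powr (-l) - profile M l ?z))"
    unfolding diff using assms nn by (intro mult_right_mono) auto
  also have "\<dots> = ?w / (p + q) * (M * (?z powr (-l) - profile M l ?z))"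
    by simp
  also have "\<dots> \<le> ?w / (p + q) * ((1 + ?z) * profile_deriv M l ?z)"
    using assms z by (intro mult_left_mono profile_supersolution) auto
  also have "\<dots> = ?w / (p + q) * (1 + ?z) * profile_deriv M l ?z"
    by simp
  also have "?w / (p + q) * (1 + ?z) = ?w * ((1 + ?z) / (p + q))"
    by simp
  also have "(1 + ?z) / (p + q) = 1 / q"
  proof -
    have "1 + ?z = (p + q) / q" "p + q \<noteq> 0"
      using assms by (simp_all add: add_divide_distrib)
    then show ?thesis by simp
  qed
  also have "?w * (1 / q) = q powr (-l - 1)"
    using assms by (simp add: powr_diff)
  also have "q powr (-l - 1) * profile_deriv M l ?z = weight_deriv M l p q"
    unfolding weight_deriv_def z ..
  finally show ?thesis .
next
  case False
  then have z: "min 1 (p / q) = 1"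
    using assms by auto
  have "weight M l q p \<le> p powr (-l)"
    using assms by (intro weight_le) auto
  also have "\<dots> \<le> q powr (-l)"
    using assms False by (intro powr_mono2') auto
  also have "\<dots> = weight M l p q"
    unfolding weight_def z using assms by (simp add: profile_one)
  finally have "a * (weight M l q p - weight M l p q) \<le> 0"
    using assms by (simp add: mult_nonneg_nonpos)
  also have "0 = weight_deriv M l p q"
    unfolding weight_deriv_def z using assms by (simp add: profile_deriv_one)
  finally show ?thesis .
qed

subsection \<open>Flux through a characteristic rectangle\<close>

lemma continuous_on_slices:
  assumes "continuous_on (S \<times> S') (\<lambda>(p, q). f p q)"
  shows "q \<in> S' \<Longrightarrow> continuous_on S (\<lambda>p. f p q)" and "p \<in> S \<Longrightarrow> continuous_on S' (\<lambda>q. f p q)"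
proof -
  have "continuous_on S (\<lambda>p. (p, q))" "continuous_on S' (\<lambda>q. (p, q))"
    by (intro continuous_intros)+
  note this[THEN continuous_on_compose2[OF assms]]
  then show "q \<in> S' \<Longrightarrow> continuous_on S (\<lambda>p. f p q)" "p \<in> S \<Longrightarrow> continuous_on S' (\<lambda>q. f p q)"
    by (simp_all add: image_subset_iff)
qed

lemma integral_DERIV:
  fixes h :: "real \<Rightarrow> real"
  assumes "c \<le> d" "\<And>x. x \<in> {c..d} \<Longrightarrow> (h has_real_derivative h' x) (at x within {c..d})"
  shows "integral {c..d} h' = h d - h c"
  using assms
  by (intro integral_unique fundamental_theorem_of_calculus) (auto simp: has_real_derivative_iff_has_vector_derivative)

text \<open>The divergence theorem on a rectangle: the integral of \<open>A' + B'\<close> is the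
  flux through the sides \<open>p0\<close>, \<open>q0\<close> minus that through \<open>p1\<close>,
  \<open>q1\<close>. Fubini lets \<open>A'\<close> be integrated in \<open>p\<close> first.\<close>

lemma rectangle_flux_le:
  fixes A B A' B' :: "real \<Rightarrow> real \<Rightarrow> real"
  assumes "p1 \<le> p0" "q1 \<le> q0"
    and A: "continuous_on ({p1..p0} \<times> {q1..q0}) (\<lambda>(p, q). A p q)"
    and B: "continuous_on ({p1..p0} \<times> {q1..q0}) (\<lambda>(p, q). B p q)"
    and A': "continuous_on ({p1..p0} \<times> {q1..q0}) (\<lambda>(p, q). A' p q)"
    and B': "continuous_on ({p1..p0} \<times> {q1..q0}) (\<lambda>(p, q). B' p q)"
    and dA: "\<And>p q. p \<in> {p1..p0} \<Longrightarrow> q \<in> {q1..q0} \<Longrightarrow>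
          ((\<lambda>p. A p q) has_real_derivative A' p q) (at p within {p1..p0})"
    and dB: "\<And>p q. p \<in> {p1..p0} \<Longrightarrow> q \<in> {q1..q0} \<Longrightarrow>
          ((\<lambda>q. B p q) has_real_derivative B' p q) (at q within {q1..q0})"
    and nonneg: "\<And>p q. p \<in> {p1..p0} \<Longrightarrow> q \<in> {q1..q0} \<Longrightarrow> 0 \<le> A' p q + B' p q"
  shows "integral {q1..q0} (A p1) + integral {p1..p0} (\<lambda>p. B p q1)
     \<le> integral {q1..q0} (A p0) + integral {p1..p0} (\<lambda>p. B p q0)"
proof -
  have swap: "integral {p1..p0} (\<lambda>p. integral {q1..q0} (A' p)) =
      integral {q1..q0} (\<lambda>q. integral {p1..p0} (\<lambda>p. A' p q))"
    using integral_swap_continuous[of p1 q1 p0 q0 A'] A' by (simp add: cbox_Pair_eq)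
  have int: "(\<lambda>p. integral {q1..q0} (A' p)) integrable_on {p1..p0}"
    "(\<lambda>p. integral {q1..q0} (B' p)) integrable_on {p1..p0}"
    using A' B' integral_continuous_on_param[of "{p1..p0}" q1 q0]
    by (auto intro!: integrable_continuous_interval)
  have ints: "A' p integrable_on {q1..q0}" "B' p integrable_on {q1..q0}" if "p \<in> {p1..p0}" for p
    using continuous_on_slices(2)[OF A' that] continuous_on_slices(2)[OF B' that]
    by (auto intro: integrable_continuous_interval)
  have "0 \<le> integral {p1..p0} (\<lambda>p. integral {q1..q0} (\<lambda>q. A' p q + B' p q))"
    using int ints nonneg by (auto intro!: integral_nonneg integrable_eq[OF integrable_add[OF int]] integrable_add simp: integral_add)
  also have "\<dots> = integral {p1..p0} (\<lambda>p. integral {q1..q0} (A' p)) + integral {p1..p0} (\<lambda>p. integral {q1..q0} (B' p))"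
    by (subst integral_add[symmetric, OF int]) (auto intro!: integral_cong simp: integral_add ints)
  also have "integral {p1..p0} (\<lambda>p. integral {q1..q0} (A' p)) = integral {q1..q0} (\<lambda>q. A p0 q - A p1 q)"
    unfolding swap using assms by (intro integral_cong integral_DERIV) auto
  also have "\<dots> = integral {q1..q0} (A p0) - integral {q1..q0} (A p1)"
    using assms(1,2) by (intro integral_diff integrable_continuous_interval continuous_on_slices(2)[OF A]) auto
  also have "integral {p1..p0} (\<lambda>p. integral {q1..q0} (B' p)) = integral {p1..p0} (\<lambda>p. B p q0 - B p q1)"
    using assms by (intro integral_cong integral_DERIV) auto
  also have "\<dots> = integral {p1..p0} (\<lambda>p. B p q0) - integral {p1..p0} (\<lambda>p. B p q1)"
    using assms(1,2) by (intro integral_diff integrable_continuous_interval continuous_on_slices(1)[OF B]) auto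
  finally show ?thesis by simp
qed

text \<open>
  \<open>f\<close> and \<open>g\<close> are the two species on the moving line, \<open>a\<close> and \<open>b\<close> half the densities of their
  collision partners. Time runs towards the corner \<open>(p1, q1)\<close>, which is the reason for the signs,
  and \<open>p + q\<close> is twice the remaining time.
\<close>

locale collision_rectangle =
  fixes f g a b :: "real \<Rightarrow> real \<Rightarrow> real" and p1 q1 s M :: real
  assumes pos: "0 < p1" "0 < q1" "p1 \<le> s" "q1 \<le> s" "1 \<le> M"
    and cont_f: "continuous_on ({p1..s} \<times> {q1..s}) (\<lambda>(p, q). f p q)"
    and cont_g: "continuous_on ({p1..s} \<times> {q1..s}) (\<lambda>(p, q). g p q)"
    and cont_a: "continuous_on ({p1..s} \<times> {q1..s}) (\<lambda>(p, q). a p q)"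
    and cont_b: "continuous_on ({p1..s} \<times> {q1..s}) (\<lambda>(p, q). b p q)"
    and deriv_f: "\<And>p q. p \<in> {p1..s} \<Longrightarrow> q \<in> {q1..s} \<Longrightarrow>
          ((\<lambda>p. f p q) has_real_derivative a p q * f p q - b p q * g p q) (at p within {p1..s})"
    and deriv_g: "\<And>p q. p \<in> {p1..s} \<Longrightarrow> q \<in> {q1..s} \<Longrightarrow>
          ((\<lambda>q. g p q) has_real_derivative b p q * g p q - a p q * f p q) (at q within {q1..s})"
    and bound_f: "\<And>p q. p \<in> {p1..s} \<Longrightarrow> q \<in> {q1..s} \<Longrightarrow> f p q \<in> {0..2 * M / (p + q)}"
    and bound_g: "\<And>p q. p \<in> {p1..s} \<Longrightarrow> q \<in> {q1..s} \<Longrightarrow> g p q \<in> {0..2 * M / (p + q)}"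
    and bound_a: "\<And>p q. p \<in> {p1..s} \<Longrightarrow> q \<in> {q1..s} \<Longrightarrow> a p q \<in> {0..M / (p + q)}"
    and bound_b: "\<And>p q. p \<in> {p1..s} \<Longrightarrow> q \<in> {q1..s} \<Longrightarrow> b p q \<in> {0..M / (p + q)}"
begin

text \<open>After collecting the terms with \<open>f\<close> and those with \<open>g\<close>, the
  divergence of the weighted flux has as coefficients the two differences that
  \<open>weight_supersolution\<close> shows to be nonnegative.\<close>

lemma weighted_flux_le:
  assumes l: "0 < l" "l < 1"
  shows "integral {q1..s} (\<lambda>q. weight M l p1 q * f p1 q) + integral {p1..s} (\<lambda>p. weight M l q1 p * g p q1)
     \<le> integral {q1..s} (\<lambda>q. weight M l s q * f s q) + integral {p1..s} (\<lambda>p. weight M l s p * g p s)"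
proof -
  let ?R = "{p1..s} \<times> {q1..s}"
  have w: "continuous_on ?R (\<lambda>(p, q). weight M l p q)" "continuous_on ?R (\<lambda>(p, q). weight M l q p)"
    "continuous_on ?R (\<lambda>(p, q). weight_deriv M l p q)" "continuous_on ?R (\<lambda>(p, q). weight_deriv M l q p)"
    unfolding case_prod_unfold using pos l
    by (auto intro!: continuous_on_weight continuous_on_weight_deriv continuous_intros)
  note cont = w cont_f cont_g cont_a cont_b
  show ?thesis
  proof (rule rectangle_flux_le[where A = "\<lambda>p q. weight M l p q * f p q" and B = "\<lambda>p q. weight M l q p * g p q"])
    show "continuous_on ?R (\<lambda>(p, q). weight M l p q * f p q)"
      "continuous_on ?R (\<lambda>(p, q). weight M l q p * g p q)"
      "continuous_on ?R (\<lambda>(p, q). weight M l p q * (a p q * f p q - b p q * g p q) + weight_deriv M l p q * f p q)"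
      "continuous_on ?R (\<lambda>(p, q). weight M l q p * (b p q * g p q - a p q * f p q) + weight_deriv M l q p * g p q)"
      using cont unfolding case_prod_unfold by (auto intro!: continuous_intros)
    fix p q assume pq: "p \<in> {p1..s}" "q \<in> {q1..s}"
    then have pq': "0 < p" "0 < q" using pos by auto
    show "((\<lambda>p. weight M l p q * f p q) has_real_derivative
        weight M l p q * (a p q * f p q - b p q * g p q) + weight_deriv M l p q * f p q) (at p within {p1..s})"
      using DERIV_mult'[OF has_field_derivative_at_within[OF weight_has_real_derivative[OF l pq']] deriv_f[OF pq]] .
    show "((\<lambda>q. weight M l q p * g p q) has_real_derivative
        weight M l q p * (b p q * g p q - a p q * f p q) + weight_deriv M l q p * g p q) (at q within {q1..s})"
      using DERIV_mult'[OF has_field_derivative_at_within[OF weight_has_real_derivative[OF l pq'(2,1)]] deriv_g[OF pq]] .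
    have "0 \<le> f p q * (weight_deriv M l p q - a p q * (weight M l q p - weight M l p q))"
      using bound_f[OF pq] bound_a[OF pq] pos l pq' by (auto intro!: mult_nonneg_nonneg weight_supersolution)
    moreover have "0 \<le> g p q * (weight_deriv M l q p - b p q * (weight M l p q - weight M l q p))"
      using bound_g[OF pq] bound_b[OF pq] pos l pq'
      by (auto intro!: mult_nonneg_nonneg weight_supersolution simp: add.commute)
    ultimately show "0 \<le> weight M l p q * (a p q * f p q - b p q * g p q) + weight_deriv M l p q * f p q +
        (weight M l q p * (b p q * g p q - a p q * f p q) + weight_deriv M l q p * g p q)"
      by (simp add: algebra_simps)
  qed (use pos in auto)
qed

text \<open>On an entrance side the weight is at most \<open>q powr (-l)\<close>, which is
  integrable down to \<open>0\<close>, so the bound does not depend on \<open>c\<close>. Since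
  \<open>l \<le> 1 / 2\<close>, the factor \<open>1 / (1 - l)\<close> is at most 2.\<close>

lemma inflow_le:
  assumes l: "0 < l" "l \<le> 1 / 2" and c: "0 < c" "c \<le> s"
    and h: "continuous_on {c..s} h" "\<And>q. q \<in> {c..s} \<Longrightarrow> h q \<in> {0..2 * M / (s + q)}"
  shows "integral {c..s} (\<lambda>q. weight M l s q * h q) \<le> 4 * M * s powr (-l)"
proof -
  have s: "0 < s" using pos by simp
  have int: "((\<lambda>q. 2 * M / s * q powr (-l)) has_integral 2 * M / s * (s powr (-l + 1) / (-l + 1))) {0..s}"
    using l s by (intro has_integral_mult_right has_integral_powr_from_0) auto
  have "integral {c..s} (\<lambda>q. weight M l s q * h q) \<le> integral {c..s} (\<lambda>q. 2 * M / s * q powr (-l))"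
  proof (rule integral_le)
    show "(\<lambda>q. weight M l s q * h q) integrable_on {c..s}"
      using l c s h by (intro integrable_continuous_interval continuous_intros continuous_on_weight) auto
    show "(\<lambda>q. 2 * M / s * q powr (-l)) integrable_on {c..s}"
      using c by (intro integrable_continuous_interval continuous_intros) auto
    fix q assume q: "q \<in> {c..s}"
    have "2 * M / (s + q) \<le> 2 * M / s"
      using q c s pos by (intro divide_left_mono) auto
    then have "h q \<le> 2 * M / s"
      using h(2)[OF q] by simp
    then have "weight M l s q * h q \<le> q powr (-l) * (2 * M / s)"
      using h(2)[OF q] q c s l pos by (intro mult_mono weight_le) auto
    then show "weight M l s q * h q \<le> 2 * M / s * q powr (-l)"
      by (simp add: mult.commute)
  qed
  also have "\<dots> \<le> integral {0..s} (\<lambda>q. 2 * M / s * q powr (-l))"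
  proof (rule integral_subset_le)
    show "(\<lambda>q. 2 * M / s * q powr (-l)) integrable_on {c..s}"
      using c by (intro integrable_continuous_interval continuous_intros) auto
    show "(\<lambda>q. 2 * M / s * q powr (-l)) integrable_on {0..s}"
      using int by blast
  qed (use c s pos in auto)
  also have "\<dots> = 2 * M * s powr (-l) * (1 / (1 - l))"
    unfolding integral_unique[OF int] powr_add using s by simp
  also have "\<dots> \<le> 2 * M * s powr (-l) * 2"
    using l pos by (intro mult_left_mono) (auto simp: field_simps)
  finally show ?thesis by simp
qed

text \<open>On the exit segment up to \<open>p'\<close> the weight is at least
  \<open>p' powr (-l) / (2 * 2 powr M)\<close>, whereas the weighted inflow through both entrance
  sides is at most \<open>8 * M * s powr (-l)\<close>. The quotient yields the decay factor
  \<open>(p' / s) powr l\<close>.\<close>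

lemma outflow_le:
  assumes l: "0 < l" "l \<le> 1 / 2" "M * 2 powr M * (l / (1 - l)) \<le> 1" and p': "p1 \<le> p'" "p' \<le> s"
  shows "integral {p1..p'} (\<lambda>p. g p q1) \<le> 16 * M * 2 powr M * (p' / s) powr l"
proof -
  have l': "l < 1" using l by simp
  have cont_out: "continuous_on {p1..s} (\<lambda>p. g p q1)"
    using continuous_on_slices(1)[OF cont_g] pos by simp
  have cont_wout: "continuous_on {p1..s} (\<lambda>p. weight M l q1 p * g p q1)"
    using pos l l' cont_out by (intro continuous_intros continuous_on_weight) auto
  have wpos: "0 \<le> weight M l x y" if "0 < x" "0 < y" for x y
    using weight_nonneg[OF l(1) l' pos(5) l(3) that] .
  let ?k = "p' powr (-l) / (2 * 2 powr M)"
  have "?k * integral {p1..p'} (\<lambda>p. g p q1) = integral {p1..p'} (\<lambda>p. ?k * g p q1)"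
    by simp
  also have "\<dots> \<le> integral {p1..p'} (\<lambda>p. weight M l q1 p * g p q1)"
  proof (rule integral_le)
    show "(\<lambda>p. ?k * g p q1) integrable_on {p1..p'}"
      "(\<lambda>p. weight M l q1 p * g p q1) integrable_on {p1..p'}"
      using p' by (auto intro!: integrable_continuous_interval continuous_intros
          continuous_on_subset[OF cont_out] continuous_on_subset[OF cont_wout])
    fix p assume "p \<in> {p1..p'}"
    then show "?k * g p q1 \<le> weight M l q1 p * g p q1"
      using bound_g[of p q1] p' pos l l' by (intro mult_right_mono weight_ge) auto
  qed
  also have "\<dots> \<le> integral {p1..s} (\<lambda>p. weight M l q1 p * g p q1)"
    using p' pos bound_g[of _ q1]
    by (intro integral_subset_le integrable_continuous_interval)
       (auto intro!: continuous_on_subset[OF cont_wout] wpos mult_nonneg_nonneg)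
  also have "\<dots> \<le> integral {q1..s} (\<lambda>q. weight M l p1 q * f p1 q) + integral {p1..s} (\<lambda>p. weight M l q1 p * g p q1)"
  proof -
    have "continuous_on {q1..s} (\<lambda>q. weight M l p1 q * f p1 q)"
      using pos l l' continuous_on_slices(2)[OF cont_f] by (intro continuous_intros continuous_on_weight) auto
    then have "0 \<le> integral {q1..s} (\<lambda>q. weight M l p1 q * f p1 q)"
      using pos bound_f[of p1]
      by (intro integral_nonneg integrable_continuous_interval mult_nonneg_nonneg wpos) auto
    then show ?thesis by simp
  qed
  also have "\<dots> \<le> integral {q1..s} (\<lambda>q. weight M l s q * f s q) + integral {p1..s} (\<lambda>p. weight M l s p * g p s)"
    using weighted_flux_le[OF l(1) l'] .
  also have "\<dots> \<le> 4 * M * s powr (-l) + 4 * M * s powr (-l)"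
  proof (intro add_mono inflow_le)
    show "continuous_on {q1..s} (f s)"
      using continuous_on_slices(2)[OF cont_f, of s] pos by simp
    show "continuous_on {p1..s} (\<lambda>p. g p s)"
      using continuous_on_slices(1)[OF cont_g, of s] pos by simp
  qed (use l pos bound_f[of s] bound_g[of _ s] in \<open>auto simp: add.commute\<close>)
  finally have "?k * integral {p1..p'} (\<lambda>p. g p q1) \<le> 8 * M * s powr (-l)"
    by simp
  then show ?thesis
    using pos p' by (simp add: powr_minus powr_divide field_simps)
qed

text \<open>Duhamel along \<open>q = q1\<close> from \<open>p'\<close> down to \<open>p1\<close>:
  the starting value is bounded directly, and the gain is at most the largest rate times the
  integral of the partner species, which \<open>outflow_le\<close> controls.\<close>

lemma corner_le:
  assumes l: "0 < l" "l \<le> 1 / 2" "M * 2 powr M * (l / (1 - l)) \<le> 1" and p': "p1 \<le> p'" "p' \<le> s"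
  shows "f p1 q1 \<le> 2 * M / (p' + q1) + M / (p1 + q1) * (16 * M * 2 powr M * (p' / s) powr l)"
proof -
  have sub: "{p1..p'} \<subseteq> {p1..s}" using p' by auto
  have cont: "continuous_on {p1..p'} (\<lambda>p. g p q1)" "continuous_on {p1..p'} (\<lambda>p. f p q1)"
    "continuous_on {p1..p'} (\<lambda>p. a p q1)" "continuous_on {p1..p'} (\<lambda>p. b p q1)"
    using continuous_on_slices(1)[OF cont_g] continuous_on_slices(1)[OF cont_f]
      continuous_on_slices(1)[OF cont_a] continuous_on_slices(1)[OF cont_b] pos
    by (auto intro: continuous_on_subset[OF _ sub])
  have "f p' q1 - f p1 q1 = integral {p1..p'} (\<lambda>p. a p q1 * f p q1 - b p q1 * g p q1)"
    using p' pos sub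
    by (intro integral_DERIV[symmetric] DERIV_subset[OF deriv_f sub]) auto
  \<comment> \<open>Time runs against \<open>p\<close>, so an upper bound at \<open>p1\<close> needs
    a lower bound on the integrand; the loss term \<open>a * f\<close> is dropped.\<close>
  moreover have "integral {p1..p'} (\<lambda>p. - (M / (p1 + q1) * g p q1))
      \<le> integral {p1..p'} (\<lambda>p. a p q1 * f p q1 - b p q1 * g p q1)"
  proof (rule integral_le)
    fix p assume p: "p \<in> {p1..p'}"
    have bd: "f p q1 \<in> {0..2 * M / (p + q1)}" "g p q1 \<in> {0..2 * M / (p + q1)}"
      "a p q1 \<in> {0..M / (p + q1)}" "b p q1 \<in> {0..M / (p + q1)}"
      using bound_f bound_g bound_a bound_b p p' pos by auto
    have "M / (p + q1) \<le> M / (p1 + q1)"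
      using p pos by (intro divide_left_mono) auto
    then have "b p q1 * g p q1 \<le> M / (p1 + q1) * g p q1"
      using bd by (intro mult_right_mono) auto
    moreover have "0 \<le> a p q1 * f p q1"
      using bd by simp
    ultimately show "- (M / (p1 + q1) * g p q1) \<le> a p q1 * f p q1 - b p q1 * g p q1"
      by simp
  qed (intro integrable_continuous_interval continuous_intros cont)+
  moreover have "M / (p1 + q1) * integral {p1..p'} (\<lambda>p. g p q1) \<le>
      M / (p1 + q1) * (16 * M * 2 powr M * (p' / s) powr l)"
    using pos by (intro mult_left_mono outflow_le assms) auto
  moreover have "f p' q1 \<le> 2 * M / (p' + q1)"
    using bound_f[of p' q1] p' pos by auto
  ultimately show ?thesis by simp
qed

end

subsection \<open>The estimate at an interior point of the cone\<close>

lemma broadwell_solutionD: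
  assumes "broadwell_solution T u"
  shows "continuous_on ({0..<T} \<times> UNIV) (\<lambda>(t, x). u i t x)"
    and "t \<in> {0..<T} \<Longrightarrow> ((\<lambda>s. u i s (y + s *\<^sub>R broadwell_speed i)) has_real_derivative
           broadwell_collision (\<lambda>j. u j t (y + t *\<^sub>R broadwell_speed i)) i) (at t within {0..<T})"
  using assms unfolding broadwell_solution_def by auto

lemma broadwell_solution_continuous_on:
  assumes "broadwell_solution T u" "continuous_on S \<alpha>" "continuous_on S \<beta>" "\<And>z. z \<in> S \<Longrightarrow> \<alpha> z \<in> {0..<T}"
  shows "continuous_on S (\<lambda>z. u i (\<alpha> z) (\<beta> z))"
proof -
  have "(\<lambda>z. (\<alpha> z, \<beta> z)) ` S \<subseteq> {0..<T} \<times> UNIV"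
    using assms(4) by auto
  from continuous_on_compose2[OF broadwell_solutionD(1)[OF assms(1)] continuous_on_Pair[OF assms(2,3)] this]
  show ?thesis by simp
qed

text \<open>Chain rule for a characteristic parametrised by \<open>p\<close> or \<open>q\<close>
  instead of time.\<close>

lemma characteristic_chain:
  fixes \<alpha> :: "real \<Rightarrow> real" and \<beta> :: "real \<Rightarrow> real^2"
  assumes "broadwell_solution T u" "p \<in> I" "\<And>p. p \<in> I \<Longrightarrow> \<alpha> p \<in> {0..<T}"
    and "(\<alpha> has_real_derivative D) (at p within I)"
    and "\<And>p. \<beta> p = y + \<alpha> p *\<^sub>R broadwell_speed i"
  shows "((\<lambda>p. u i (\<alpha> p) (\<beta> p)) has_real_derivative
           broadwell_collision (\<lambda>k. u k (\<alpha> p) (\<beta> p)) i * D) (at p within I)"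
proof -
  have sub: "\<alpha> ` I \<subseteq> {0..<T}" using assms(3) by auto
  show ?thesis
    using DERIV_image_chain[OF DERIV_subset[OF broadwell_solutionD(2)[OF assms(1) assms(3)[OF assms(2)]] sub] assms(4)]
    by (simp add: o_def assms(5))
qed

text \<open>Species \<open>i\<close> and \<open>j\<close> share the first velocity component
  \<open>d\<close>; \<open>i'\<close> and \<open>j'\<close> are their collision partners. There are
  three scales of remaining time: the mass decays from \<open>s\<close> to \<open>\<rho>'\<close>,
  and Duhamel runs from \<open>\<rho>'\<close> to \<open>\<rho>\<close>. The parameters
  \<open>d\<close> and \<open>e\<close> treat all four species at once.\<close>

lemma strip_estimate:
  fixes u :: "4 \<Rightarrow> real \<Rightarrow> real^2 \<Rightarrow> real" and X :: "real^2"
  assumes sol: "broadwell_solution T u"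
    and nonneg: "\<And>k t x. t \<in> {0..<T} \<Longrightarrow> 0 \<le> u k t x"
    and bound: "\<And>k t x. t \<in> {T - s..T - \<rho>} \<Longrightarrow> \<bar>x$1 - X$1\<bar> \<le> T - t \<Longrightarrow> \<bar>x$2 - X$2\<bar> \<le> T - t
        \<Longrightarrow> u k t x \<le> M / (T - t)"
    and speed: "broadwell_speed i = vector [d, e]" "broadwell_speed j = vector [d, -e]"
    and de: "\<bar>d\<bar> = 1" "\<bar>e\<bar> = 1"
    and coll: "\<And>v. broadwell_collision v i = v j * v j' - v i * v i'"
      "\<And>v. broadwell_collision v j = v i * v i' - v j * v j'"
    and M: "1 \<le> M" and l: "0 < l" "l \<le> 1 / 2" "M * 2 powr M * (l / (1 - l)) \<le> 1"
    and \<rho>: "0 < \<rho>" "\<rho> \<le> \<rho>'" "2 * \<rho>' \<le> s" "s \<le> T"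
    and x: "\<bar>x$1 - X$1\<bar> < \<rho>" "\<bar>x$2 - X$2\<bar> < \<rho>"
  shows "u i (T - \<rho>) x \<le> M / \<rho>' + M / (2 * \<rho>) * (16 * M * 2 powr M * (2 * \<rho>' / s) powr l)"
proof -
  \<comment> \<open>The sign \<open>e\<close> orients the second axis so that species
    \<open>i\<close> always moves with decreasing \<open>p\<close>.\<close>
  define p1 where "p1 = \<rho> - e * (x$2 - X$2)"
  define q1 where "q1 = \<rho> + e * (x$2 - X$2)"
  \<comment> \<open>The point reached from \<open>x\<close> by going back for time
    \<open>(p - p1) / 2\<close> along species \<open>i\<close> and for time
    \<open>(q - q1) / 2\<close> along species \<open>j\<close>; the remaining time there is
    \<open>(p + q) / 2\<close>.\<close>
  define pos where "pos p q = x + ((p1 - p) / 2) *\<^sub>R broadwell_speed i + ((q1 - q) / 2) *\<^sub>R broadwell_speed j"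
    for p q
  define U where "U k p q = u k (T - (p + q) / 2) (pos p q)" for k p q
  let ?R = "{p1..s} \<times> {q1..s}"
  have "\<bar>e * (x$2 - X$2)\<bar> < \<rho>" using x de by (simp add: abs_mult)
  then have pq1: "0 < p1" "0 < q1" "p1 \<le> 2 * \<rho>" "q1 \<le> 2 * \<rho>" and sum: "p1 + q1 = 2 * \<rho>"
    by (auto simp: p1_def q1_def abs_less_iff)
  have e2: "e * e = 1"
    using de by (metis abs_mult_self_eq mult_1)
  have time: "T - (p + q) / 2 \<in> {0..<T}" "T - (p + q) / 2 \<in> {T - s..T - \<rho>}"
    if "p \<in> {p1..s}" "q \<in> {q1..s}" for p q
    using that pq1 \<rho> sum by auto
  \<comment> \<open>The whole rectangle lies in the backward cone, where the assumed bound on the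
    densities holds.\<close>
  have posX: "\<bar>pos p q $ 1 - X$1\<bar> \<le> (p + q) / 2" "\<bar>pos p q $ 2 - X$2\<bar> \<le> (p + q) / 2"
    if "p \<in> {p1..s}" "q \<in> {q1..s}" for p q
  proof -
    have "pos p q $ 1 - X$1 = (x$1 - X$1) + d * (\<rho> - (p + q) / 2)"
    proof -
      have \<rho>_eq: "\<rho> = (p1 + q1) / 2" using sum by simp
      show ?thesis unfolding pos_def speed \<rho>_eq by (simp add: field_simps)
    qed
    also have "\<bar>\<dots>\<bar> \<le> \<bar>x$1 - X$1\<bar> + \<bar>\<rho> - (p + q) / 2\<bar>"
      by (rule order_trans[OF abs_triangle_ineq]) (simp add: abs_mult de)
    also have "\<dots> = \<bar>x$1 - X$1\<bar> + ((p + q) / 2 - \<rho>)"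
      using that sum by simp
    also have "\<dots> \<le> (p + q) / 2"
      using x by linarith
    finally show "\<bar>pos p q $ 1 - X$1\<bar> \<le> (p + q) / 2" .
    have "e * (pos p q $ 2 - X$2) = e * (x$2 - X$2) + e * e * ((p1 - p) / 2) - e * e * ((q1 - q) / 2)"
      unfolding pos_def speed by (simp add: field_simps)
    also have "\<dots> = (q - p) / 2"
      unfolding e2 p1_def q1_def by (simp add: field_simps)
    finally have "\<bar>pos p q $ 2 - X$2\<bar> = \<bar>q - p\<bar> / 2"
      by (metis abs_divide abs_mult abs_numeral de(2) mult_1)
    then show "\<bar>pos p q $ 2 - X$2\<bar> \<le> (p + q) / 2"
      using that pq1 by auto
  qed
  have Ub: "U k p q \<in> {0..2 * M / (p + q)}" if "p \<in> {p1..s}" "q \<in> {q1..s}" for k p q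
    using bound[OF time(2)[OF that], of "pos p q" k] posX[OF that] nonneg[OF time(1)[OF that], of k]
    by (simp add: U_def mult.commute)
  have cont: "continuous_on ?R (\<lambda>(p, q). U k p q)" for k
    unfolding U_def pos_def case_prod_unfold
    by (intro broadwell_solution_continuous_on[OF sol] continuous_intros time) auto
  have di: "((\<lambda>p. U i p q) has_real_derivative
      U i' p q / 2 * U i p q - U j' p q / 2 * U j p q) (at p within {p1..s})"
    if "p \<in> {p1..s}" "q \<in> {q1..s}" for p q
  proof -
    have "((\<lambda>p. u i (T - (p + q) / 2) (pos p q)) has_real_derivative
      broadwell_collision (\<lambda>k. u k (T - (p + q) / 2) (pos p q)) i * (- 1 / 2)) (at p within {p1..s})"
    proof (rule characteristic_chain[OF sol that(1) time(1)[OF _ that(2)]])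
      show "((\<lambda>p. T - (p + q) / 2) has_real_derivative - 1 / 2) (at p within {p1..s})"
        by (auto intro!: derivative_eq_intros)
      show "pos p q = (x + ((p1 + q) / 2 - T) *\<^sub>R broadwell_speed i + ((q1 - q) / 2) *\<^sub>R broadwell_speed j)
          + (T - (p + q) / 2) *\<^sub>R broadwell_speed i" for p
        unfolding pos_def by (simp add: vec_eq_iff field_simps)
    qed
    then show ?thesis
      unfolding U_def by (rule DERIV_cong) (simp add: coll algebra_simps)
  qed
  have dj: "((\<lambda>q. U j p q) has_real_derivative
      U j' p q / 2 * U j p q - U i' p q / 2 * U i p q) (at q within {q1..s})"
    if "p \<in> {p1..s}" "q \<in> {q1..s}" for p q
  proof -
    have "((\<lambda>q. u j (T - (p + q) / 2) (pos p q)) has_real_derivative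
      broadwell_collision (\<lambda>k. u k (T - (p + q) / 2) (pos p q)) j * (- 1 / 2)) (at q within {q1..s})"
    proof (rule characteristic_chain[OF sol that(2) time(1)[OF that(1)]])
      show "((\<lambda>q. T - (p + q) / 2) has_real_derivative - 1 / 2) (at q within {q1..s})"
        by (auto intro!: derivative_eq_intros)
      show "pos p q = (x + ((q1 + p) / 2 - T) *\<^sub>R broadwell_speed j + ((p1 - p) / 2) *\<^sub>R broadwell_speed i)
          + (T - (p + q) / 2) *\<^sub>R broadwell_speed j" for q
        unfolding pos_def by (simp add: vec_eq_iff field_simps)
    qed
    then show ?thesis
      unfolding U_def by (rule DERIV_cong) (simp add: coll algebra_simps)
  qed
  \<comment> \<open>The partner densities are halved because a unit of \<open>p\<close> or
    \<open>q\<close> is half a unit of time.\<close>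
  interpret collision_rectangle "U i" "U j" "\<lambda>p q. U i' p q / 2" "\<lambda>p q. U j' p q / 2" p1 q1 s M
  proof
    show "continuous_on ?R (\<lambda>(p, q). U i' p q / 2)" "continuous_on ?R (\<lambda>(p, q). U j' p q / 2)"
      using cont[of i'] cont[of j'] unfolding case_prod_unfold by (auto intro!: continuous_intros)
    show "U i' p q / 2 \<in> {0..M / (p + q)}" "U j' p q / 2 \<in> {0..M / (p + q)}"
      if "p \<in> {p1..s}" "q \<in> {q1..s}" for p q
      using Ub[OF that, of i'] Ub[OF that, of j'] by (auto simp: mult.commute)
  qed (use pq1 \<rho> M cont di dj Ub in auto)
  \<comment> \<open>With this choice the point \<open>(p', q1)\<close> has remaining time exactly
    \<open>\<rho>'\<close>.\<close>
  define p' where "p' = 2 * \<rho>' - q1"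
  have p': "p1 \<le> p'" "p' \<le> s" "p' \<le> 2 * \<rho>'" "0 < p'"
    using pq1 \<rho> sum by (auto simp: p'_def)
  have "u i (T - \<rho>) x = U i p1 q1"
    by (simp add: U_def pos_def sum)
  also have "\<dots> \<le> 2 * M / (p' + q1) + M / (p1 + q1) * (16 * M * 2 powr M * (p' / s) powr l)"
    by (rule corner_le[OF l p'(1,2)])
  also have "2 * M / (p' + q1) = M / \<rho>'"
    by (simp add: p'_def)
  also have "M / (p1 + q1) * (16 * M * 2 powr M * (p' / s) powr l) \<le>
      M / (2 * \<rho>) * (16 * M * 2 powr M * (2 * \<rho>' / s) powr l)"
    unfolding sum using p' \<rho> l M pq1 by (intro mult_left_mono powr_mono2 divide_right_mono) auto
  finally show ?thesis by simp
qed

section \<open>Elementary bounds on the collision term and the speeds\<close>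

lemma broadwell_collision_le:
  assumes "\<And>k. 0 \<le> v k" "\<And>k. v k \<le> c"
  shows "broadwell_collision v i \<le> c * c"
proof -
  have "v j * v k \<le> c * c" "0 \<le> v j * v k" for j k
    using assms order_trans[OF assms] by (auto intro: mult_mono)
  then show ?thesis
    unfolding broadwell_collision_def by (smt (verit))
qed

lemma broadwell_speed_component: "\<bar>broadwell_speed i $ k\<bar> = 1"
  unfolding broadwell_speed_def using exhaust_2[of k] by auto

subsection \<open>Continuation past a small square\<close>

lemma open_Collect_all_less:
  fixes f :: "'i::finite \<Rightarrow> 'a::topological_space \<Rightarrow> real"
  assumes "\<And>i. continuous_on UNIV (f i)"
  shows "open {x. \<forall>i. f i x < c}"
proof -
  have "{x. \<forall>i. f i x < c} = (\<Inter>i. {x. f i x < c})"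
    by auto
  then show ?thesis
    using assms by (auto intro!: open_INT open_Collect_less continuous_on_const)
qed

text \<open>The compact square has a uniform \<open>\<epsilon>\<close>-neighbourhood inside
  \<open>U\<close>. Clamping the coordinates of a nearby point to the square moves each by at most
  \<open>\<epsilon> / 3\<close>, hence the point by less than \<open>\<epsilon>\<close>.\<close>

lemma open_square_margin:
  fixes X :: "real^2" and U :: "(real^2) set"
  assumes "open U" "0 < \<rho>" "\<And>x. \<bar>x$1 - X$1\<bar> \<le> \<rho> \<Longrightarrow> \<bar>x$2 - X$2\<bar> \<le> \<rho> \<Longrightarrow> x \<in> U"
  obtains \<delta> where "0 < \<delta>"
    "\<And>x. \<bar>x$1 - X$1\<bar> \<le> \<rho> + \<delta> \<Longrightarrow> \<bar>x$2 - X$2\<bar> \<le> \<rho> + \<delta> \<Longrightarrow> x \<in> U"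
proof -
  define S where "S = cbox (X - vec \<rho>) (X + vec \<rho>)"
  have S: "x \<in> S \<longleftrightarrow> \<bar>x$1 - X$1\<bar> \<le> \<rho> \<and> \<bar>x$2 - X$2\<bar> \<le> \<rho>" for x
    by (auto simp: S_def mem_box_cart forall_2 abs_le_iff)
  have "compact S" by (simp add: S_def compact_cbox)
  moreover have "S \<subseteq> U" using assms(3) S by blast
  ultimately obtain \<epsilon> where \<epsilon>: "0 < \<epsilon>" "(\<Union>x\<in>S. ball x \<epsilon>) \<subseteq> U"
    using compact_subset_open_imp_ball_epsilon_subset[OF _ assms(1)] by metis
  show ?thesis
  proof
    show "0 < \<epsilon> / 3" using \<epsilon> by simp
    fix x :: "real^2" assume x: "\<bar>x$1 - X$1\<bar> \<le> \<rho> + \<epsilon> / 3" "\<bar>x$2 - X$2\<bar> \<le> \<rho> + \<epsilon> / 3"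
    define y :: "real^2" where "y = (\<chi> k. X$k + max (- \<rho>) (min \<rho> (x$k - X$k)))"
    have "y \<in> S"
      using assms(2) by (auto simp: S y_def)
    have "dist y x \<le> (\<Sum>k\<in>UNIV. \<bar>(y - x)$k\<bar>)"
      unfolding dist_norm by (rule norm_le_l1_cart)
    also have "\<dots> = \<bar>y$1 - x$1\<bar> + \<bar>y$2 - x$2\<bar>"
      by (simp add: sum_2)
    also have "\<dots> \<le> \<epsilon> / 3 + \<epsilon> / 3"
      using x assms(2) \<epsilon>(1) by (intro add_mono) (auto simp: y_def max_def min_def abs_if split: if_splits)
    also have "\<dots> < \<epsilon>" using \<epsilon> by simp
    finally have "x \<in> ball y \<epsilon>" by simp
    then show "x \<in> U" using \<epsilon>(2) \<open>y \<in> S\<close> by blast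
  qed
qed

text \<open>First contact with a barrier \<open>V\<close> that rises from
  \<open>1 / (4 * \<rho>)\<close> and stays below \<open>1 / (2 * \<rho>)\<close> before
  \<open>T\<close>. Up to the first contact the collision term is at most the slope of
  \<open>V\<close>, so the gap along the characteristic cannot close. The margin
  \<open>\<delta>\<close> keeps a full neighbourhood of \<open>X\<close> inside the cone up to time
  \<open>T\<close>.\<close>

lemma bounded_after_small:
  fixes u :: "4 \<Rightarrow> real \<Rightarrow> real^2 \<Rightarrow> real" and X x2 :: "real^2"
  assumes sol: "broadwell_solution T u"
    and nonneg: "\<And>k t x. t \<in> {0..<T} \<Longrightarrow> 0 \<le> u k t x"
    and \<rho>: "0 < \<rho>" "\<rho> \<le> T" "0 < \<delta>"
    and small: "\<And>k x. \<bar>x$1 - X$1\<bar> \<le> \<rho> + \<delta> \<Longrightarrow> \<bar>x$2 - X$2\<bar> \<le> \<rho> + \<delta> \<Longrightarrow> u k (T - \<rho>) x < 1 / (4 * \<rho>)"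
    and t2: "t2 \<in> {T - \<rho>..<T}" and x2: "\<bar>x2$1 - X$1\<bar> \<le> \<delta>" "\<bar>x2$2 - X$2\<bar> \<le> \<delta>"
  shows "u i t2 x2 \<le> 1 / (2 * \<rho>)"
proof (rule ccontr)
  assume big: "\<not> u i t2 x2 \<le> 1 / (2 * \<rho>)"
  \<comment> \<open>a supersolution: \<open>V' = 1 / (4 \<rho>\<^sup>2) \<ge> V\<^sup>2\<close> as long as \<open>V \<le> 1 / (2 \<rho>)\<close>\<close>
  define V where "V t = 1 / (4 * \<rho>) + (t - (T - \<rho>)) / (4 * \<rho> * \<rho>)" for t
  \<comment> \<open>A domain of dependence widened by \<open>\<delta>\<close>, cut off at
    \<open>t2 < T\<close> so that it is compact and the solution is continuous on it.\<close>
  define R where "R = {z :: real \<times> (real^2). T - \<rho> \<le> fst z \<and> fst z \<le> t2 \<and>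
      (\<bar>snd z$1 - X$1\<bar> \<le> T - fst z + \<delta> \<and> \<bar>snd z$2 - X$2\<bar> \<le> T - fst z + \<delta>)}"
  have "closed R"
    unfolding R_def by (intro closed_Collect_conj closed_Collect_le continuous_intros)
  moreover have "R \<subseteq> {T - \<rho>..t2} \<times> cbox (X - vec (\<rho> + \<delta>)) (X + vec (\<rho> + \<delta>))"
    by (auto simp: R_def mem_box_cart forall_2 abs_le_iff)
  ultimately have "compact R"
    using compact_Int_closed[OF compact_Times[OF compact_Icc compact_cbox]] by (metis Int_absorb1)
  have contR: "continuous_on R (\<lambda>z. u k (fst z) (snd z))" for k
    using t2 \<rho> by (intro broadwell_solution_continuous_on[OF sol] continuous_intros) (auto simp: R_def)
  have V: "continuous_on S (\<lambda>z. V (\<alpha> z))" if "continuous_on S \<alpha>" for S :: "'b::topological_space set" and \<alpha>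
    unfolding V_def using \<rho> that by (intro continuous_intros) auto
  \<comment> \<open>The contact set; its compactness provides a contact of earliest time.\<close>
  define B where "B = (\<Union>k. {z \<in> R. V (fst z) \<le> u k (fst z) (snd z)})"
  have "compact {z \<in> R. V (fst z) \<le> u k (fst z) (snd z)}" for k
  proof -
    have "closed {z \<in> R. V (fst z) \<le> u k (fst z) (snd z)}"
      using \<open>closed R\<close> contR by (intro continuous_on_closed_Collect_le V continuous_intros)
    from compact_Int_closed[OF \<open>compact R\<close> this] show ?thesis
      by (simp add: Int_absorb1 Collect_restrict)
  qed
  then have "compact B" unfolding B_def by (intro compact_UN) auto
  have Vle: "V t < 1 / (2 * \<rho>)" if "t < T" for t
  proof -
    have "(t - (T - \<rho>)) / (4 * \<rho> * \<rho>) < \<rho> / (4 * \<rho> * \<rho>)"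
      using that \<rho> by (intro divide_strict_right_mono) auto
    then show ?thesis using \<rho> by (simp add: V_def)
  qed
  have "(t2, x2) \<in> B"
    using Vle[of t2] big t2 x2 by (auto simp: B_def R_def intro!: exI[of _ i])
  then obtain z where z: "z \<in> B" "\<And>z'. z' \<in> B \<Longrightarrow> fst z \<le> fst z'"
    using continuous_attains_inf[OF \<open>compact B\<close> _ continuous_on_fst[OF continuous_on_id]] by blast
  obtain tb xb where zb: "z = (tb, xb)" by (cases z)
  obtain j where j: "V tb \<le> u j tb xb" and R: "(tb, xb) \<in> R"
    using z(1) unfolding B_def zb by auto
  let ?x = "\<lambda>s. xb + (s - tb) *\<^sub>R broadwell_speed j"
  have tb: "T - \<rho> \<le> tb" "tb \<le> t2" "tb < T" using R t2 by (auto simp: R_def)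
  \<comment> \<open>Going back in time, \<open>R\<close> widens at unit rate and each velocity
    component has modulus 1, so the characteristic stays in \<open>R\<close>.\<close>
  have inR: "(s, ?x s) \<in> R" if "s \<in> {T - \<rho>..tb}" for s
  proof -
    have "\<bar>?x s $ k - X$k\<bar> \<le> \<bar>xb$k - X$k\<bar> + \<bar>(s - tb) * broadwell_speed j $ k\<bar>" for k
      by simp
    then have "\<bar>?x s $ k - X$k\<bar> \<le> \<bar>xb$k - X$k\<bar> + (tb - s)" for k
      using that by (simp add: abs_mult broadwell_speed_component)
    from this[of 1] this[of 2] R that show ?thesis
      by (auto simp: R_def)
  qed
  have line: "?x s = (xb - tb *\<^sub>R broadwell_speed j) + s *\<^sub>R broadwell_speed j" for s
    by (simp add: algebra_simps)
  let ?y = "\<lambda>s. u j s (?x s) - V s"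
  have "?y tb \<le> ?y (T - \<rho>)"
  proof (rule DERIV_nonpos_imp_decreasing_open[OF tb(1)])
    show "continuous_on {T - \<rho>..tb} ?y"
      using tb \<rho> by (intro continuous_intros V broadwell_solution_continuous_on[OF sol]) auto
    fix s assume s: "T - \<rho> < s" "s < tb"
    then have s': "s \<in> {0<..<T}" "s \<in> {0..<T}" using \<rho> tb by auto
    have "at s within {0..<T} = at s"
      using s' by (intro at_within_interior) auto
    then have "((\<lambda>s. u j s (?x s)) has_real_derivative broadwell_collision (\<lambda>k. u k s (?x s)) j) (at s)"
      using broadwell_solutionD(2)[OF sol s'(2)] unfolding line by simp
    moreover have "(V has_real_derivative 1 / (4 * \<rho> * \<rho>)) (at s)"
      unfolding V_def[abs_def] using \<rho> by (auto intro!: derivative_eq_intros)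
    ultimately have "(?y has_real_derivative
        broadwell_collision (\<lambda>k. u k s (?x s)) j - 1 / (4 * \<rho> * \<rho>)) (at s)"
      by (rule DERIV_diff)
    moreover have "broadwell_collision (\<lambda>k. u k s (?x s)) j \<le> 1 / (2 * \<rho>) * (1 / (2 * \<rho>))"
    proof (rule broadwell_collision_le)
      fix k
      show "0 \<le> u k s (?x s)" using nonneg s' by auto
      have "(s, ?x s) \<notin> B" using z(2)[of "(s, ?x s)"] s zb by auto
      then have "u k s (?x s) < V s" using inR[of s] s by (auto simp: B_def not_le)
      also have "\<dots> < 1 / (2 * \<rho>)" using Vle s tb by auto
      finally show "u k s (?x s) \<le> 1 / (2 * \<rho>)" by simp
    qed
    ultimately show "\<exists>y. (?y has_real_derivative y) (at s) \<and> y \<le> 0"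
      by (intro exI conjI) auto
  qed
  also have "?y (T - \<rho>) < 0"
    using small[of "?x (T - \<rho>)" j] inR[of "T - \<rho>"] tb by (simp add: V_def R_def)
  finally show False using j by simp
qed

subsection \<open>Excluding blow-up\<close>

text \<open>The last power is the exponential of a negative quantity of order
  \<open>N powr (3 / 4) / ln N\<close>, which beats every power of \<open>N\<close>.\<close>

lemma corner_bound_tendsto_0:
  "((\<lambda>N. ln (3 * N) / 4 * exp (-N) + 8 * (ln (3 * N) / 4)\<^sup>2 * (3 * N) powr (1 / 4) *
      (2 * exp (-N)) powr (1 / (1 + ln (3 * N) / 4 * (3 * N) powr (1 / 4)))) \<longlongrightarrow> (0::real)) at_top"
  by real_asymp

text \<open>\<open>strip_estimate\<close> is applied with remaining times \<open>s\<close>,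
  \<open>s\<^sup>2\<close>, \<open>s\<^sup>3\<close>, that is at rescaled times \<open>N\<close>,
  \<open>2 * N\<close>, \<open>3 * N\<close>, for one large \<open>N\<close>.\<close>

lemma small_square_exists:
  fixes u :: "4 \<Rightarrow> real \<Rightarrow> real^2 \<Rightarrow> real" and X :: "real^2"
  assumes "T > 0"
    and sol: "broadwell_solution T u"
    and nonneg: "\<And>k t x. t \<in> {0..<T} \<Longrightarrow> 0 \<le> u k t x"
    and "\<theta> < 1/4"
    and growth: "\<forall>i. \<forall>\<^sub>F \<tau> in at_top. \<forall>\<xi>. \<bar>\<xi>$1\<bar> \<le> 1 \<and> \<bar>\<xi>$2\<bar> \<le> 1 \<longrightarrow>
           rescaled u T X i \<tau> \<xi> \<le> \<theta> * ln \<tau>"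
  obtains \<rho> where "0 < \<rho>" "\<rho> \<le> T"
    "\<And>k x. \<bar>x$1 - X$1\<bar> \<le> \<rho> \<Longrightarrow> \<bar>x$2 - X$2\<bar> \<le> \<rho> \<Longrightarrow> u k (T - \<rho>) x < 1 / (4 * \<rho>)"
proof -
  \<comment> \<open>\<open>M N\<close> bounds the rescaled densities up to rescaled time
    \<open>3 * N\<close>, \<open>K N = exp (M N)\<close> dominates \<open>2 powr M N\<close>, and
    \<open>l N\<close> is chosen so that \<open>l N / (1 - l N) = 1 / (M N * K N)\<close>, which
    gives the smallness condition on \<open>l\<close>. \<open>E N\<close> is \<open>\<rho>\<close>
    times the resulting bound.\<close>
  define M where "M N = ln (3 * N) / 4" for N :: real
  define K where "K N = (3 * N) powr (1 / 4)" for N :: real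
  define l where "l N = 1 / (1 + M N * K N)" for N :: real
  define E where "E N = M N * exp (-N) + 8 * (M N)\<^sup>2 * K N * (2 * exp (-N)) powr l N" for N
  have "\<forall>\<^sub>F \<tau> in at_top. \<forall>i \<xi>. \<bar>\<xi>$1\<bar> \<le> 1 \<and> \<bar>\<xi>$2\<bar> \<le> 1 \<longrightarrow> rescaled u T X i \<tau> \<xi> \<le> \<theta> * ln \<tau>"
    using growth by (simp add: eventually_all_finite)
  then obtain N0 where N0: "\<And>\<tau> i \<xi>. N0 \<le> \<tau> \<Longrightarrow> \<bar>\<xi>$1\<bar> \<le> 1 \<Longrightarrow> \<bar>\<xi>$2\<bar> \<le> 1 \<Longrightarrow>
      rescaled u T X i \<tau> \<xi> \<le> \<theta> * ln \<tau>"
    unfolding eventually_at_top_linorder by blast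
  have "(E \<longlongrightarrow> 0) at_top"
    unfolding E_def M_def l_def K_def by (rule corner_bound_tendsto_0)
  then have "\<forall>\<^sub>F N in at_top. E N < 1 / 4"
    by (rule order_tendstoD) simp
  moreover have "\<forall>\<^sub>F N in at_top. 1 \<le> M N" "\<forall>\<^sub>F N in at_top. 2 * exp (-N) \<le> (1::real)"
    unfolding M_def by real_asymp+
  moreover have "\<forall>\<^sub>F N::real in at_top. max N0 (max 1 (- ln T)) \<le> N"
    by (rule eventually_ge_at_top)
  ultimately have "\<forall>\<^sub>F N in at_top. E N < 1 / 4 \<and> 1 \<le> M N \<and> 2 * exp (-N) \<le> 1 \<and> max N0 (max 1 (- ln T)) \<le> N"
    by eventually_elim auto
  then obtain N where N: "E N < 1 / 4" "1 \<le> M N" "2 * exp (-N) \<le> 1" "N0 \<le> N" "1 \<le> N" "- ln T \<le> N"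
    by (auto dest!: eventually_happens)
  define s where "s = exp (-N)"
  have s: "0 < s" "2 * s \<le> 1" "s \<le> T"
  proof -
    show "0 < s" "2 * s \<le> 1" using N by (simp_all add: s_def)
    have "exp (-N) \<le> exp (ln T)" using N by (subst exp_le_cancel_iff) simp
    then show "s \<le> T" using assms(1) by (simp add: s_def)
  qed
  define \<rho> where "\<rho> = s ^ 3"
  have \<rho>: "0 < \<rho>" "\<rho> \<le> s\<^sup>2" "2 * s\<^sup>2 \<le> s"
    using s by (auto simp: \<rho>_def power3_eq_cube power2_eq_square mult_le_cancel_right1)
  have exp3: "\<rho> = exp (- (3 * N))"
    by (simp add: \<rho>_def s_def flip: exp_of_nat_mult)
  have K: "2 powr M N \<le> K N"
  proof -
    have "2 powr M N \<le> exp 1 powr M N"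
      using N(2) exp_ge_add_one_self[of 1] by (intro powr_mono2) auto
    also have "\<dots> = K N"
      using N(5) by (simp add: M_def K_def powr_def)
    finally show ?thesis .
  qed
  have l: "0 < l N" "l N \<le> 1 / 2" "M N * 2 powr M N * (l N / (1 - l N)) \<le> 1"
  proof -
    have "1 \<le> K N"
      using K ge_one_powr_ge_zero[of 2 "M N"] N(2) by simp
    then have A: "1 * 1 \<le> M N * K N"
      using N(2) by (intro mult_mono) auto
    then show "0 < l N" "l N \<le> 1 / 2"
      by (auto simp: l_def field_simps)
    have "l N / (1 - l N) = 1 / (M N * K N)"
      using A by (simp add: l_def divide_simps)
    then have "M N * 2 powr M N * (l N / (1 - l N)) = 2 powr M N / K N"
      using N(2) by simp
    then show "M N * 2 powr M N * (l N / (1 - l N)) \<le> 1"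
      using K \<open>1 \<le> K N\<close> by simp
  qed
  have bound: "u k t x \<le> M N / (T - t)"
    if t: "t \<in> {T - s..T - \<rho>}" and x: "\<bar>x$1 - X$1\<bar> \<le> T - t" "\<bar>x$2 - X$2\<bar> \<le> T - t" for k t x
  proof -
    define \<tau> where "\<tau> = - ln (T - t)"
    have Tt: "0 < T - t" "T - t \<le> s" "\<rho> \<le> T - t" using t \<rho> by auto
    have "ln (T - t) \<le> ln s" "ln \<rho> \<le> ln (T - t)"
      using Tt \<rho> s by (simp_all only: ln_le_cancel_iff)
    then have \<tau>: "N \<le> \<tau>" "\<tau> \<le> 3 * N"
      by (auto simp: \<tau>_def s_def exp3)
    let ?\<xi> = "(x - X) /\<^sub>R (T - t)"
    have "\<bar>?\<xi> $ m\<bar> = \<bar>x$m - X$m\<bar> / (T - t)" for m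
      using Tt by (simp add: abs_mult divide_inverse mult.commute)
    then have \<xi>: "\<bar>?\<xi> $ 1\<bar> \<le> 1" "\<bar>?\<xi> $ 2\<bar> \<le> 1"
      using x Tt by auto
    have "(T - t) * u k t x = rescaled u T X k \<tau> ?\<xi>"
      unfolding \<tau>_def using Tt by (subst rescaled_eq) auto
    also have "\<dots> \<le> \<theta> * ln \<tau>"
      using \<xi> \<tau> N by (intro N0) auto
    also have "\<dots> \<le> 1 / 4 * ln \<tau>"
      using assms(4) \<tau> N by (intro mult_right_mono) auto
    also have "\<dots> \<le> M N"
      using \<tau> N by (simp add: M_def)
    finally show ?thesis using Tt by (simp add: field_simps)
  qed
  have interior: "u k (T - \<rho>) x \<le> E N / \<rho>" if "\<bar>x$1 - X$1\<bar> < \<rho>" "\<bar>x$2 - X$2\<bar> < \<rho>" for k x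
  proof -
    \<comment> \<open>The intermediate scale \<open>\<rho>'\<close> is \<open>s\<^sup>2\<close>.
      Below, each species is paired with the one having the same first velocity component.\<close>
    note est = strip_estimate[OF sol nonneg bound _ _ _ _ _ _ N(2) l \<rho>(1-3) s(3) that]
    have "u k (T - \<rho>) x \<le> M N / s\<^sup>2 + M N / (2 * \<rho>) * (16 * M N * 2 powr M N * (2 * s\<^sup>2 / s) powr l N)"
      using exhaust_4[of k]
    proof (elim disjE)
      assume [simp]: "k = 1"
      show ?thesis
        by (rule est[where j = 2 and d = 1 and e = 1 and i' = 3 and j' = 4])
           (auto simp: broadwell_speed_def broadwell_collision_def)
    next
      assume [simp]: "k = 2"
      show ?thesis
        by (rule est[where j = 1 and d = 1 and e = "-1" and i' = 4 and j' = 3])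
           (auto simp: broadwell_speed_def broadwell_collision_def)
    next
      assume [simp]: "k = 3"
      show ?thesis
        by (rule est[where j = 4 and d = "-1" and e = "-1" and i' = 1 and j' = 2])
           (auto simp: broadwell_speed_def broadwell_collision_def)
    next
      assume [simp]: "k = 4"
      show ?thesis
        by (rule est[where j = 3 and d = "-1" and e = 1 and i' = 2 and j' = 1])
           (auto simp: broadwell_speed_def broadwell_collision_def)
    qed
    also have "\<dots> \<le> M N / s\<^sup>2 + M N / (2 * \<rho>) * (16 * M N * K N * (2 * s\<^sup>2 / s) powr l N)"
      using K N(2) \<rho>(1) by (intro add_mono mult_left_mono mult_right_mono) auto
    also have "\<dots> = (M N * s + 8 * (M N)\<^sup>2 * K N * (2 * s) powr l N) / \<rho>"
      using s by (simp add: \<rho>_def field_simps power2_eq_square power3_eq_cube)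
    also have "\<dots> = E N / \<rho>"
      by (simp add: E_def s_def)
    finally show ?thesis .
  qed
  have "u k (T - \<rho>) x < 1 / (4 * \<rho>)" if x: "\<bar>x$1 - X$1\<bar> \<le> \<rho>" "\<bar>x$2 - X$2\<bar> \<le> \<rho>" for k x
  proof -
    have Tr: "T - \<rho> \<in> {0..<T}" using \<rho> s by auto
    \<comment> \<open>The interior estimate needs \<open>p1\<close> and \<open>q1\<close> positive,
      hence the open square; continuity extends it to the boundary.\<close>
    have "closed {x. u k (T - \<rho>) x \<le> E N / \<rho>}"
      using Tr by (intro closed_Collect_le broadwell_solution_continuous_on[OF sol] continuous_intros) auto
    moreover have "box (X - vec \<rho>) (X + vec \<rho>) \<subseteq> {x. u k (T - \<rho>) x \<le> E N / \<rho>}"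
      by (auto intro!: interior simp: mem_box_cart forall_2 abs_less_iff)
    ultimately have "closure (box (X - vec \<rho>) (X + vec \<rho>)) \<subseteq> {x. u k (T - \<rho>) x \<le> E N / \<rho>}"
      by (intro closure_minimal)
    moreover have "X \<in> box (X - vec \<rho>) (X + vec \<rho>)"
      using \<rho> by (simp add: mem_box_cart forall_2)
    ultimately have "cbox (X - vec \<rho>) (X + vec \<rho>) \<subseteq> {x. u k (T - \<rho>) x \<le> E N / \<rho>}"
      by (subst closure_box[symmetric]) auto
    moreover have "x \<in> cbox (X - vec \<rho>) (X + vec \<rho>)"
      using x by (auto simp: mem_box_cart forall_2 abs_le_iff)
    ultimately have "u k (T - \<rho>) x \<le> E N / \<rho>" by blast
    also have "\<dots> < 1 / 4 / \<rho>" using N(1) \<rho>(1) by (rule divide_strict_right_mono)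
    finally show ?thesis by simp
  qed
  then show ?thesis
    using that[of \<rho>] \<rho> s by simp
qed

theorem theorem5p2:
  fixes u :: "4 \<Rightarrow> real \<Rightarrow> real^2 \<Rightarrow> real" and T \<theta> :: real and X :: "real^2"
  assumes "T > 0"
    and "broadwell_solution T u"
    and "\<forall>i. \<forall>t\<in>{0..<T}. \<forall>x. u i t x \<ge> 0"
    and "\<theta> < 1/4"
    and "\<forall>i. \<forall>\<^sub>F \<tau> in at_top. \<forall>\<xi>. \<bar>\<xi>$1\<bar> \<le> 1 \<and> \<bar>\<xi>$2\<bar> \<le> 1 \<longrightarrow>
           rescaled u T X i \<tau> \<xi> \<le> \<theta> * ln \<tau>"
  shows "(\<forall>i K. compact K \<longrightarrow> uniform_limit K (rescaled u T X i) (\<lambda>_. 0) at_top) \<and>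
         \<not> blow_up_point u T X"
proof -
  have nonneg: "0 \<le> u k t x" if "t \<in> {0..<T}" for k t x
    using assms(3) that by blast
  obtain \<rho> where \<rho>: "0 < \<rho>" "\<rho> \<le> T" and
    small: "\<And>k x. \<bar>x$1 - X$1\<bar> \<le> \<rho> \<Longrightarrow> \<bar>x$2 - X$2\<bar> \<le> \<rho> \<Longrightarrow> u k (T - \<rho>) x < 1 / (4 * \<rho>)"
    using small_square_exists[OF assms(1,2) nonneg assms(4,5)] by blast
  \<comment> \<open>Strict smallness on the closed square persists on a slightly larger one, as
    \<open>bounded_after_small\<close> requires.\<close>
  have "open {x. \<forall>k. u k (T - \<rho>) x < 1 / (4 * \<rho>)}"
    using \<rho> by (intro open_Collect_all_less broadwell_solution_continuous_on[OF assms(2)] continuous_intros) auto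
  then obtain \<delta> where \<delta>: "0 < \<delta>" and
    small': "\<And>k x. \<bar>x$1 - X$1\<bar> \<le> \<rho> + \<delta> \<Longrightarrow> \<bar>x$2 - X$2\<bar> \<le> \<rho> + \<delta> \<Longrightarrow> u k (T - \<rho>) x < 1 / (4 * \<rho>)"
    using open_square_margin[of _ \<rho> X] \<rho> small by (smt (verit) mem_Collect_eq)
  define C where "C = 1 / (2 * \<rho>)"
  have "0 < C" using \<rho> by (simp add: C_def)
  have bounded: "u k t x \<le> C" if "t \<in> {T - \<rho>..<T}" "norm (x - X) \<le> \<delta>" for k t x
    unfolding C_def
  proof (rule bounded_after_small[OF assms(2) nonneg \<rho> \<delta> small' that(1)])
    show "\<bar>x$1 - X$1\<bar> \<le> \<delta>" "\<bar>x$2 - X$2\<bar> \<le> \<delta>"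
      using component_le_norm_cart[of "x - X" 1] component_le_norm_cart[of "x - X" 2] that(2) by simp_all
  qed
  have "uniform_limit K (rescaled u T X i) (\<lambda>_. 0) at_top" if "compact K" for i K
  proof (rule uniform_limitI)
    fix \<epsilon> :: real assume "0 < \<epsilon>"
    obtain r where r: "0 < r" "\<And>\<xi>. \<xi> \<in> K \<Longrightarrow> norm \<xi> \<le> r"
      using compact_imp_bounded[OF \<open>compact K\<close>] by (auto simp: bounded_pos)
    have lim: "((\<lambda>\<tau>. exp (-\<tau>) * c) \<longlongrightarrow> 0) at_top" for c :: real
      by real_asymp
    \<comment> \<open>In turn: the points \<open>X + exp (-\<tau>) *\<^sub>R \<xi>\<close> are
      within \<open>\<delta>\<close> of \<open>X\<close>, the bound \<open>C\<close> rescales to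
      less than \<open>\<epsilon>\<close>, and the time is past \<open>T - \<rho>\<close>. The
      factor 1 only matches the form of \<open>lim\<close>.\<close>
    have "\<forall>\<^sub>F \<tau> in at_top. exp (-\<tau>) * r < \<delta> \<and> exp (-\<tau>) * C < \<epsilon> \<and> exp (-\<tau>) * 1 < \<rho>"
      using \<delta> \<rho> \<open>0 < \<epsilon>\<close> by (intro eventually_conj order_tendstoD(2)[OF lim])
    then show "\<forall>\<^sub>F \<tau> in at_top. \<forall>\<xi>\<in>K. dist (rescaled u T X i \<tau> \<xi>) 0 < \<epsilon>"
    proof eventually_elim
      case (elim \<tau>)
      show ?case
      proof
        fix \<xi> assume "\<xi> \<in> K"
        let ?t = "T - exp (-\<tau>)" and ?x = "X + exp (-\<tau>) *\<^sub>R \<xi>"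
        have t: "?t \<in> {T - \<rho>..<T}" "?t \<in> {0..<T}" using elim \<rho> by auto
        have "exp (-\<tau>) * norm \<xi> \<le> exp (-\<tau>) * r"
          using r(2)[OF \<open>\<xi> \<in> K\<close>] by simp
        also have "\<dots> \<le> \<delta>" using elim by simp
        finally have "norm (?x - X) \<le> \<delta>" by simp
        from bounded[OF t(1) this, of i] have "exp (-\<tau>) * u i ?t ?x \<le> exp (-\<tau>) * C"
          by (intro mult_left_mono) auto
        also have "\<dots> < \<epsilon>" using elim by simp
        finally show "dist (rescaled u T X i \<tau> \<xi>) 0 < \<epsilon>"
          using nonneg[OF t(2), of i ?x] by (simp add: rescaled_def abs_mult)
      qed
    qed
  qed
  moreover have "\<not> blow_up_point u T X"
  proof
    assume "blow_up_point u T X"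
    then obtain i where i: "Limsup (at_left T \<times>\<^sub>F nhds X) (\<lambda>(t, x). ereal (u i t x)) = \<infinity>"
      unfolding blow_up_point_def by blast
    have "\<forall>\<^sub>F t in at_left T. t \<in> {T - \<rho><..<T}"
      using \<rho> by (intro eventually_at_leftI[of "T - \<rho>"]) auto
    moreover have "\<forall>\<^sub>F x in nhds X. x \<in> ball X \<delta>"
      using \<delta> by (intro eventually_nhds_in_open) auto
    ultimately have "\<forall>\<^sub>F (t, x) in at_left T \<times>\<^sub>F nhds X. t \<in> {T - \<rho><..<T} \<and> x \<in> ball X \<delta>"
      by (rule eventually_prodI[THEN eventually_mono]) auto
    then have "\<forall>\<^sub>F z in at_left T \<times>\<^sub>F nhds X. (case z of (t, x) \<Rightarrow> ereal (u i t x)) \<le> ereal C"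
      by (rule eventually_mono) (auto intro!: bounded simp: dist_norm norm_minus_commute)
    from Limsup_bounded[OF this] i show False by simp
  qed
  ultimately show ?thesis by blast
qed

end
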